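(* Let $g\in\mathcal S(\mathbb R)$ be a window function and let $f(x)=A(x)e^{2\pi i\phi(x)}$, $x\in\mathbb R$, where $A>0$, $\log A$ is a real polynomial of degree at most $3$ (so $\log A(x)=\sum_{j=0}^{3}[\log A]^{(j)}(t)\frac{(x-t)^j}{j!}$ for all $x,t$), and $\phi$ is a real cubic polynomial. Assume that the chirplet transforms involved are well defined, i.e. $\int_{\mathbb R}|f(x)||x-t|^j|g(x-t)|\,dx<\infty$ for all $t\in\mathbb R$ and all integers $j\ge 0$. Then at every $(t,\xi,\lambda)\in\mathbb R^3$ at which $\theta_f^{(g)}$, $\tilde\mu_f^{(g)}$, $\tilde\omega_f^{(g)}$ are defined (that is, $T_f^{(g)}\neq 0$, $q_f^0\ne 0$ and $2+\partial_t(q^1_f/q^0_f)\neq 0$ at that point) one has $$\mathrm{Re}\,\theta_f^{(g)}(t,\xi,\lambda)=\phi'''(t),\qquad \mathrm{Re}\,\tilde\mu_f^{(g)}(t,\xi,\lambda)=\phi''(t),\qquad \mathrm{Re}\,\tilde\omega_f^{(g)}(t,\xi,\lambda)=\phi'(t).$$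
   Context: The chirplet transform of $f$ with window $g$ is $$T_f^{(g)}(t,\xi,\lambda)=\int_{\mathbb R} f(x)\,g^*(x-t)\,e^{-2\pi i\xi(x-t)-\pi i\lambda(x-t)^2}\,dx,$$ where $g^*$ is the complex conjugate of $g$. For an integer $j\ge 0$, $T_f^{(t^jg)}$ denotes the chirplet transform with window $x\mapsto x^jg(x)$ (so the factor $(x-t)^jg^*(x-t)$ appears in the integral). All functions below are functions of $(t,\xi,\lambda)$, and we write $T=T_f^{(g)}$. For $j=0,1$ define $$q_f^j=(j+1)\frac{T_f^{(t^jg)}}{T}+\partial_t\left(\frac{T_f^{(t^{j+1}g)}}{T}\right),$$ and define $$\theta_f^{(g)}=\frac{\frac{1}{\pi i}\,\partial_t\left(\frac{\partial_t(\partial_tT/T)}{q_f^0}\right)}{2+\partial_t\left(q_f^1/q_f^0\right)},$$ $$\tilde\mu_f^{(g)}=\frac{1}{2\pi i}\,\frac{(2q_f^0+\partial_tq_f^1)\,\partial_t\left(\frac{\partial_tT}{T}\right)-q_f^1\,\partial_{tt}^2\left(\frac{\partial_tT}{T}\right)}{2(q_f^0)^2+q_f^0\,\partial_tq_f^1-q_f^1\,\partial_tq_f^0},$$ $$\tilde\omega_f^{(g)}=\frac{1}{2\pi i}\frac{\partial_tT}{T}-\tilde\mu_f^{(g)}\,\frac{T_f^{(tg)}}{T}-\frac12\,\theta_f^{(g)}\,\frac{T_f^{(t^2g)}}{T}.$$ *)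

theory Defs
  imports "HOL-Analysis.Analysis" "HOL-Computational_Algebra.Polynomial"
begin

text \<open>Iterated derivatives of a complex-valued function of a real variable
  (the library's \<open>deriv\<close> requires domain and codomain to coincide).\<close>

definition nth_vderiv :: "nat \<Rightarrow> (real \<Rightarrow> complex) \<Rightarrow> real \<Rightarrow> complex" where
  "nth_vderiv n g = ((\<lambda>h x. vector_derivative h (at x)) ^^ n) g"

definition schwartz :: "(real \<Rightarrow> complex) \<Rightarrow> bool" where
  "schwartz g \<longleftrightarrow>
     (\<forall>n x. nth_vderiv n g differentiable (at x)) \<and>
     (\<forall>k n. bounded (range (\<lambda>x. complex_of_real (x ^ k) * nth_vderiv n g x)))"

definition chirplet ::
  "(real \<Rightarrow> complex) \<Rightarrow> (real \<Rightarrow> complex) \<Rightarrow> real \<Rightarrow> real \<Rightarrow> real \<Rightarrow> complex" where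
  "chirplet f g t \<xi> l =
     (LINT x|lborel. f x * cnj (g (x - t)) *
        exp (- 2 * complex_of_real pi * \<i> * complex_of_real \<xi> * complex_of_real (x - t)
             - complex_of_real pi * \<i> * complex_of_real l * (complex_of_real (x - t))\<^sup>2))"

definition mono_window :: "nat \<Rightarrow> (real \<Rightarrow> complex) \<Rightarrow> real \<Rightarrow> complex" where
  "mono_window j g x = complex_of_real (x ^ j) * g x"

definition dt :: "(real \<Rightarrow> real \<Rightarrow> real \<Rightarrow> complex) \<Rightarrow> real \<Rightarrow> real \<Rightarrow> real \<Rightarrow> complex" where
  "dt F t \<xi> l = vector_derivative (\<lambda>s. F s \<xi> l) (at t)"

definition T_ratio ::
  "nat \<Rightarrow> (real \<Rightarrow> complex) \<Rightarrow> (real \<Rightarrow> complex) \<Rightarrow> real \<Rightarrow> real \<Rightarrow> real \<Rightarrow> complex" where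
  "T_ratio j f g t \<xi> l = chirplet f (mono_window j g) t \<xi> l / chirplet f g t \<xi> l"

definition T_logderiv ::
  "(real \<Rightarrow> complex) \<Rightarrow> (real \<Rightarrow> complex) \<Rightarrow> real \<Rightarrow> real \<Rightarrow> real \<Rightarrow> complex" where
  "T_logderiv f g t \<xi> l = dt (chirplet f g) t \<xi> l / chirplet f g t \<xi> l"

definition q ::
  "nat \<Rightarrow> (real \<Rightarrow> complex) \<Rightarrow> (real \<Rightarrow> complex) \<Rightarrow> real \<Rightarrow> real \<Rightarrow> real \<Rightarrow> complex" where
  "q j f g t \<xi> l = of_nat (j + 1) * T_ratio j f g t \<xi> l + dt (T_ratio (j + 1) f g) t \<xi> l"

definition \<theta>_est ::
  "(real \<Rightarrow> complex) \<Rightarrow> (real \<Rightarrow> complex) \<Rightarrow> real \<Rightarrow> real \<Rightarrow> real \<Rightarrow> complex" where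
  "\<theta>_est f g t \<xi> l =
     (1 / (complex_of_real pi * \<i>) *
        dt (\<lambda>t \<xi> l. dt (T_logderiv f g) t \<xi> l / q 0 f g t \<xi> l) t \<xi> l)
     / (2 + dt (\<lambda>t \<xi> l. q 1 f g t \<xi> l / q 0 f g t \<xi> l) t \<xi> l)"

definition \<mu>_est ::
  "(real \<Rightarrow> complex) \<Rightarrow> (real \<Rightarrow> complex) \<Rightarrow> real \<Rightarrow> real \<Rightarrow> real \<Rightarrow> complex" where
  "\<mu>_est f g t \<xi> l =
     1 / (2 * complex_of_real pi * \<i>) *
     (((2 * q 0 f g t \<xi> l + dt (q 1 f g) t \<xi> l) * dt (T_logderiv f g) t \<xi> l
        - q 1 f g t \<xi> l * dt (dt (T_logderiv f g)) t \<xi> l)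
      / (2 * (q 0 f g t \<xi> l)\<^sup>2 + q 0 f g t \<xi> l * dt (q 1 f g) t \<xi> l
        - q 1 f g t \<xi> l * dt (q 0 f g) t \<xi> l))"

definition \<omega>_est ::
  "(real \<Rightarrow> complex) \<Rightarrow> (real \<Rightarrow> complex) \<Rightarrow> real \<Rightarrow> real \<Rightarrow> real \<Rightarrow> complex" where
  "\<omega>_est f g t \<xi> l =
     1 / (2 * complex_of_real pi * \<i>) * T_logderiv f g t \<xi> l
     - \<mu>_est f g t \<xi> l * T_ratio 1 f g t \<xi> l
     - 1 / 2 * \<theta>_est f g t \<xi> l * T_ratio 2 f g t \<xi> l"

end

theory Submission imports Defs begin

text \<open>
  Since \<open>ln A\<close> and \<open>\<phi>\<close> are at most cubic polynomials, \<open>f = exp L\<close> for the complex polynomial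
  \<open>L = ln A + 2 \<pi> \<i> \<phi>\<close>, so \<open>f' = L' f\<close>. Write \<open>T\<^sub>j\<close> for the chirplet transform with window
  \<open>x\<^sup>j g(x)\<close>, as a function of \<open>t\<close>. After the substitution \<open>x = t + u\<close> the variable \<open>t\<close> occurs only
  in \<open>f (t + u)\<close>; differentiating under the integral sign and expanding the quadratic polynomial
  \<open>L' (t + u)\<close> in powers of \<open>u\<close> gives the linear recursion

    \<open>T\<^sub>j' = L' T\<^sub>j + L'' T\<^sub>j\<^sub>+\<^sub>1 + (L'''/2) T\<^sub>j\<^sub>+\<^sub>2\<close>

  (lemma \<open>chirplet_cubic_has_vector_derivative\<close>).

  The rest is algebra (lemma \<open>estimators_of_chirplet_recursion\<close>). With \<open>R\<^sub>j = T\<^sub>j / T\<^sub>0\<close> the recursion for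
  \<open>j = 0\<close> reads \<open>T\<^sub>0'/T\<^sub>0 = L' + L'' R\<^sub>1 + (L'''/2) R\<^sub>2\<close>. Since \<open>L'''\<close> is constant, differentiating once
  gives \<open>(T\<^sub>0'/T\<^sub>0)' = L'' q\<^sub>0 + (L'''/2) q\<^sub>1\<close> with \<open>q\<^sub>0 = 1 + R\<^sub>1'\<close> and \<open>q\<^sub>1 = 2 R\<^sub>1 + R\<^sub>2'\<close>.
  Dividing by \<open>q\<^sub>0\<close> and differentiating again yields \<open>(L'''/2) (2 + (q\<^sub>1/q\<^sub>0)')\<close>, which isolates \<open>L'''\<close>.
  Together with the second derivative of \<open>T\<^sub>0'/T\<^sub>0\<close>, Cramer's rule isolates \<open>L''\<close>, its determinant
  being \<open>q\<^sub>0\<^sup>2 (2 + (q\<^sub>1/q\<^sub>0)')\<close>; finally \<open>L'\<close> is read off from the first formula. So the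
  estimators for \<open>\<phi>'''\<close>, \<open>\<phi>''\<close> and \<open>\<phi>'\<close> equal \<open>L'''\<close>, \<open>L''\<close> and \<open>L'\<close> divided by \<open>2 \<pi> \<i>\<close>, and passing to real parts removes the
  contribution of \<open>ln A\<close> and leaves the derivatives of \<open>\<phi>\<close>.

  The analytic point is the domination needed for differentiating under the integral, where the
  integrability of \<open>f (s + u)\<close> against the window is known for each fixed \<open>s\<close> but has to be made locally
  uniform in \<open>s\<close>. Lemma \<open>exp_poly_shift_le\<close> does this: the exponential of a real polynomial at any
  point of an interval of length two is bounded by a constant times the sum of its values at the two
  endpoints, with a constant that does not depend on where the interval lies.
\<close>

section \<open>Differentiation under the integral sign\<close>

lemma has_vector_derivative_iff_tendsto_quotient:
  fixes f :: "real \<Rightarrow> 'b::real_normed_vector"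
  shows "(f has_vector_derivative D) (at x within S) \<longleftrightarrow>
    ((\<lambda>y. (f y - f x) /\<^sub>R (y - x)) \<longlongrightarrow> D) (at x within S)"
proof -
  have *: "norm (f y - f x - (y - x) *\<^sub>R D) / norm (y - x)
      = norm ((f y - f x) /\<^sub>R (y - x) - D)" if "y \<noteq> x" for y
  proof -
    have "f y - f x - (y - x) *\<^sub>R D = (y - x) *\<^sub>R ((f y - f x) /\<^sub>R (y - x) - D)"
      using that by (simp add: scaleR_right_diff_distrib)
    then show ?thesis using that by simp
  qed
  have "(f has_vector_derivative D) (at x within S) \<longleftrightarrow>
    ((\<lambda>y. norm (f y - f x - (y - x) *\<^sub>R D) / norm (y - x)) \<longlongrightarrow> 0) (at x within S)"
    unfolding has_vector_derivative_def has_derivative_iff_norm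
    by (simp add: bounded_linear_scaleR_left)
  also have "\<dots> \<longleftrightarrow> ((\<lambda>y. norm ((f y - f x) /\<^sub>R (y - x) - D)) \<longlongrightarrow> 0) (at x within S)"
    by (rule filterlim_cong) (use * in \<open>auto simp: eventually_at_filter\<close>)
  also have "\<dots> \<longleftrightarrow> ((\<lambda>y. (f y - f x) /\<^sub>R (y - x)) \<longlongrightarrow> D) (at x within S)"
    by (simp add: tendsto_norm_zero_iff LIM_zero_iff)
  finally show ?thesis .
qed

text \<open>The mean value inequality bounds every difference quotient by \<open>H\<close>, so dominated convergence
  applies along each sequence tending to \<open>t\<close>.\<close>

lemma has_vector_derivative_integral_dominated:
  fixes F F' :: "real \<Rightarrow> 'a \<Rightarrow> 'b::{banach, second_countable_topology}"
  assumes "a < t" "t < b"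
    and F: "\<And>s. s \<in> {a..b} \<Longrightarrow> integrable M (F s)"
    and meas: "F' t \<in> borel_measurable M"
    and deriv: "\<And>s x. s \<in> {a..b} \<Longrightarrow> ((\<lambda>r. F r x) has_vector_derivative F' s x) (at s)"
    and H: "integrable M H"
    and bound: "\<And>s x. s \<in> {a..b} \<Longrightarrow> norm (F' s x) \<le> H x"
  shows "((\<lambda>s. LINT x|M. F s x) has_vector_derivative (LINT x|M. F' t x)) (at t)"
proof -
  have at_t: "at t within {a..b} = at t"
    using assms(1,2) by (simp add: at_within_Icc_at)
  have t: "t \<in> {a..b}" using assms(1,2) by simp
  have lipschitz: "norm (F s x - F t x) \<le> H x * norm (s - t)" if "s \<in> {a..b}" for s x
  proof (rule differentiable_bound[where S = "{a..b}" and f' = "\<lambda>s h. h *\<^sub>R F' s x"])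
    show "((\<lambda>r. F r x) has_derivative (\<lambda>h. h *\<^sub>R F' r x)) (at r within {a..b})"
      if "r \<in> {a..b}" for r
      using deriv[OF that] has_vector_derivative_at_within
      unfolding has_vector_derivative_def by (metis has_derivative_at_withinI)
    show "onorm (\<lambda>h. h *\<^sub>R F' r x) \<le> H x" if "r \<in> {a..b}" for r
      using bound[OF that, of x] by (intro onorm_le) (simp add: mult.commute mult_left_mono)
  qed (use that t in auto)
  have "((\<lambda>s. ((LINT x|M. F s x) - (LINT x|M. F t x)) /\<^sub>R (s - t)) \<longlongrightarrow> (LINT x|M. F' t x))
      (at t within {a..b})"
    unfolding tendsto_at_iff_sequentially
  proof (intro allI impI)
    fix X :: "nat \<Rightarrow> real"
    assume X: "\<forall>i. X i \<in> {a..b} - {t}" "X \<longlonglongrightarrow> t"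
    have "(\<lambda>i. LINT x|M. (F (X i) x - F t x) /\<^sub>R (X i - t)) \<longlonglongrightarrow> (LINT x|M. F' t x)"
    proof (rule integral_dominated_convergence[OF meas _ H])
      show "(\<lambda>x. (F (X i) x - F t x) /\<^sub>R (X i - t)) \<in> borel_measurable M" for i
        using F[of "X i"] F[OF t] X(1)
        by (intro borel_measurable_scaleR borel_measurable_diff borel_measurable_integrable) auto
      show "AE x in M. (\<lambda>i. (F (X i) x - F t x) /\<^sub>R (X i - t)) \<longlonglongrightarrow> F' t x"
      proof (rule AE_I2)
        fix x
        have "((\<lambda>y. (F y x - F t x) /\<^sub>R (y - t)) \<longlongrightarrow> F' t x) (at t within {a..b})"
          using deriv[OF t, of x] unfolding at_t has_vector_derivative_iff_tendsto_quotient .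
        then show "(\<lambda>i. (F (X i) x - F t x) /\<^sub>R (X i - t)) \<longlonglongrightarrow> F' t x"
          using X unfolding tendsto_at_iff_sequentially by (auto simp: o_def)
      qed
      show "AE x in M. norm ((F (X i) x - F t x) /\<^sub>R (X i - t)) \<le> H x" for i
      proof (rule AE_I2)
        fix x
        show "norm ((F (X i) x - F t x) /\<^sub>R (X i - t)) \<le> H x"
          using lipschitz[of "X i" x] X(1) by (auto simp: divide_simps mult.commute)
      qed
    qed
    moreover have "(LINT x|M. (F (X i) x - F t x) /\<^sub>R (X i - t))
        = ((LINT x|M. F (X i) x) - (LINT x|M. F t x)) /\<^sub>R (X i - t)" for i
    proof -
      have "integrable M (F (X i))" using F X(1) by blast
      then have "(LINT x|M. F (X i) x - F t x) = (LINT x|M. F (X i) x) - (LINT x|M. F t x)"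
        by (rule Bochner_Integration.integral_diff[OF _ F[OF t]])
      then show ?thesis by (simp only: integral_scaleR_right)
    qed
    ultimately show "((\<lambda>s. ((LINT x|M. F s x) - (LINT x|M. F t x)) /\<^sub>R (s - t)) \<circ> X)
        \<longlonglongrightarrow> (LINT x|M. F' t x)"
      by (simp only: o_def)
  qed
  then show ?thesis
    unfolding at_t by (simp add: has_vector_derivative_iff_tendsto_quotient)
qed

section \<open>Shifts of the exponential of a polynomial\<close>

text \<open>If the maximum of \<open>P\<close> over \<open>[y - 1, y + 1]\<close> is attained at an endpoint, the constant 1 does. An
  interior maximum point is a root of the derivative of \<open>P\<close>; for a nonconstant \<open>P\<close> this confines \<open>y\<close>
  to a fixed bounded set, on which compactness provides the constant.\<close>

lemma exp_poly_shift_le: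
  fixes P :: "real poly"
  obtains K where "\<And>y h. \<bar>h\<bar> \<le> 1 \<Longrightarrow>
    exp (poly P (y + h)) \<le> K * (exp (poly P (y - 1)) + exp (poly P (y + 1)))"
proof (cases "pderiv P = 0")
  case True
  then obtain c where "P = [:c:]"
    by (meson degree_eq_zeroE pderiv_eq_0_iff)
  then show ?thesis using that[of 1] by simp
next
  case False
  then have "finite {x. poly (pderiv P) x = 0}" by (rule poly_roots_finite)
  then have "bounded {x. poly (pderiv P) x = 0}" by (rule finite_imp_bounded)
  then obtain B where B: "\<And>x. poly (pderiv P) x = 0 \<Longrightarrow> \<bar>x\<bar> \<le> B"
    unfolding bounded_iff real_norm_def by blast
  have "bounded (poly P ` {-B-2..B+2})"
    by (intro compact_imp_bounded compact_continuous_image continuous_intros compact_Icc)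
  then obtain C where C: "\<And>x. x \<in> {-B-2..B+2} \<Longrightarrow> \<bar>poly P x\<bar> \<le> C"
    unfolding bounded_iff real_norm_def by blast
  show ?thesis
  proof (rule that[of "1 + exp (2 * C)"])
    fix y h :: real assume h: "\<bar>h\<bar> \<le> 1"
    obtain z where z: "z \<in> {y-1..y+1}" and
      zmax: "\<And>x. x \<in> {y-1..y+1} \<Longrightarrow> poly P x \<le> poly P z"
      using continuous_attains_sup[of "{y-1..y+1}" "poly P"]
      by (force intro: continuous_intros)
    have le_z: "poly P (y + h) \<le> poly P z" using h by (intro zmax) auto
    define E where "E = exp (poly P (y - 1)) + exp (poly P (y + 1))"
    have E_le: "E \<le> (1 + exp (2 * C)) * E" by (simp add: E_def algebra_simps add_increasing)
    consider "z = y - 1" | "z = y + 1" | "y - 1 < z" "z < y + 1" using z by fastforce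
    then have "exp (poly P (y + h)) \<le> (1 + exp (2 * C)) * E"
    proof cases
      case 3
      have "poly (pderiv P) z = 0"
      proof (rule DERIV_local_max[OF poly_DERIV])
        show "0 < min (z - (y - 1)) (y + 1 - z)" using 3 by simp
        show "\<forall>x. \<bar>z - x\<bar> < min (z - (y - 1)) (y + 1 - z) \<longrightarrow> poly P x \<le> poly P z"
          by (auto intro!: zmax)
      qed
      then have zB: "\<bar>z\<bar> \<le> B" by (rule B)
      have "poly P z \<le> 2 * C + poly P (y + 1)"
        using C[of z] C[of "y + 1"] zB 3 by (simp add: abs_le_iff)
      then have "exp (poly P (y + h)) \<le> exp (2 * C) * exp (poly P (y + 1))"
        using le_z by (simp flip: exp_add)
      then show ?thesis by (simp add: E_def algebra_simps add_increasing add_increasing2)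
    next
      case 1
      then have "exp (poly P (y + h)) \<le> E" using le_z by (simp add: E_def add_increasing2)
      then show ?thesis using E_le by linarith
    next
      case 2
      then have "exp (poly P (y + h)) \<le> E" using le_z by (simp add: E_def add_increasing)
      then show ?thesis using E_le by linarith
    qed
    then show "exp (poly P (y + h)) \<le> (1 + exp (2 * C)) * (exp (poly P (y - 1)) + exp (poly P (y + 1)))"
      unfolding E_def .
  qed
qed

section \<open>The partial derivative in time\<close>

lemma has_vector_derivative_divide_field:
  fixes f h :: "real \<Rightarrow> 'a::real_normed_field"
  assumes "(f has_vector_derivative f') (at x)" "(h has_vector_derivative h') (at x)" "h x \<noteq> 0"
  shows "((\<lambda>x. f x / h x) has_vector_derivative (f' * h x - f x * h') / (h x)\<^sup>2) (at x)"
proof -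
  have "((\<lambda>x. inverse (h x)) has_vector_derivative h' * - (inverse (h x) ^ 2)) (at x)"
    using field_vector_diff_chain_at[OF assms(2) DERIV_inverse[OF assms(3)]]
    by (simp add: o_def numeral_2_eq_2)
  from has_vector_derivative_mult[OF assms(1) this] show ?thesis
    using assms(3) by (simp add: field_simps power2_eq_square)
qed

text \<open>The closed forms computed below hold only where the denominators do not vanish, that is near \<open>t\<close>,
  which is all that \<open>dt\<close> depends on.\<close>

lemma dt_eqI:
  assumes "(h has_vector_derivative D) (at t)" "eventually (\<lambda>s. F s \<xi> l = h s) (nhds t)"
  shows "dt F t \<xi> l = D"
proof -
  from assms(2) obtain S where "open S" "t \<in> S" "\<And>s. s \<in> S \<Longrightarrow> h s = F s \<xi> l"
    unfolding eventually_nhds by metis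
  with assms(1) have "((\<lambda>s. F s \<xi> l) has_vector_derivative D) (at t)"
    by (rule has_vector_derivative_transform_within_open)
  then show ?thesis unfolding dt_def by (rule vector_derivative_at)
qed

section \<open>The recursion for chirplet transforms of a cubic chirp\<close>

lemma mono_window_0: "mono_window 0 g = g"
  by (simp add: mono_window_def fun_eq_iff)

text \<open>The three coefficients are \<open>L'\<close>, \<open>L''\<close> and \<open>L'''/2\<close> for the cubic exponent \<open>L\<close>: they are the Taylor
  coefficients in \<open>L' (t + u) = L' t + L'' t * u + (L'''/2) * u\<^sup>2\<close>, and every factor \<open>u\<close> raises the
  index of the window by one.\<close>

lemma chirplet_cubic_has_vector_derivative:
  fixes f g :: "real \<Rightarrow> complex" and c0 c1 c2 c3 :: complex
  assumes f: "\<And>x. f x = exp (c0 + c1 * of_real x + c2 * (of_real x)\<^sup>2 + c3 * (of_real x) ^ 3)"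
    and g: "continuous_on UNIV g"
    and int: "\<And>s j. integrable lborel (\<lambda>x. cmod (f x) * \<bar>x - s\<bar> ^ j * cmod (g (x - s)))"
  shows "((\<lambda>s. chirplet f (mono_window j g) s \<xi> l) has_vector_derivative
      (c1 + 2 * c2 * of_real t + 3 * c3 * (of_real t)\<^sup>2) * chirplet f (mono_window j g) t \<xi> l
      + (2 * c2 + 6 * c3 * of_real t) * chirplet f (mono_window (j + 1) g) t \<xi> l
      + 3 * c3 * chirplet f (mono_window (j + 2) g) t \<xi> l) (at t)"
proof -
  define L1 where "L1 = (\<lambda>s::real. c1 + 2 * c2 * of_real s + 3 * c3 * (of_real s)\<^sup>2)"
  define L2 where "L2 = (\<lambda>s::real. 2 * c2 + 6 * c3 * of_real s)"
  define w where "w = (\<lambda>k u. of_real (u ^ k) * cnj (g u) *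
     exp (- 2 * complex_of_real pi * \<i> * complex_of_real \<xi> * complex_of_real u
             - complex_of_real pi * \<i> * complex_of_real l * (complex_of_real u)\<^sup>2))"
  define I where "I = (\<lambda>a k u. cmod (f (a + u)) * \<bar>u\<bar> ^ k * cmod (g u))"
  have norm_fw: "cmod (f (s + u) * w k u) = I s k u" for s k u
    by (simp add: w_def I_def norm_mult norm_exp_eq_Re norm_power power2_eq_square)
  have w_Suc: "w (k + 1) u = of_real u * w k u" "w (k + 2) u = (of_real u)\<^sup>2 * w k u" for k u
    by (simp_all add: w_def power2_eq_square mult_ac)
  have chirplet_eq: "chirplet f (mono_window k g) s \<xi> l = (LINT u|lborel. f (s + u) * w k u)" for k s
    unfolding chirplet_def mono_window_def
    by (subst lborel_integral_real_affine[where c = 1 and t = s]) (simp_all add: w_def mult_ac)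
  have intI: "integrable lborel (I a k)" for a k
    using lborel_integrable_real_affine[OF int[of a k], of 1 a] by (simp add: I_def)
  have cont_f: "continuous_on UNIV f"
    unfolding f by (intro continuous_intros)
  have cont_fw: "continuous_on UNIV (\<lambda>u. f (s + u) * w k u)" for s k
    unfolding w_def
    by (intro continuous_intros g continuous_on_compose2[OF cont_f]) auto
  have int_fw: "integrable lborel (\<lambda>u. f (s + u) * w k u)" for s k
  proof (rule Bochner_Integration.integrable_bound[OF intI[of s k]])
    show "(\<lambda>u. f (s + u) * w k u) \<in> borel_measurable lborel"
      using cont_fw by (simp add: borel_measurable_continuous_onI)
    show "AE u in lborel. cmod (f (s + u) * w k u) \<le> norm (I s k u)"
      unfolding norm_fw by simp
  qed
  have L1_shift: "L1 (s + u) = L1 s + L2 s * of_real u + 3 * c3 * (of_real u)\<^sup>2" for s u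
    by (simp add: L1_def L2_def algebra_simps power2_eq_square)
  have F'_eq: "L1 (s + u) * f (s + u) * w j u
      = L1 s * (f (s + u) * w j u) + L2 s * (f (s + u) * w (j + 1) u)
        + 3 * c3 * (f (s + u) * w (j + 2) u)" for s u
    unfolding L1_shift w_Suc by (simp add: algebra_simps)

  obtain K where K: "\<And>y h. \<bar>h\<bar> \<le> 1 \<Longrightarrow> cmod (f (y + h)) \<le> K * (cmod (f (y - 1)) + cmod (f (y + 1)))"
  proof -
    have "cmod (f x) = exp (poly [:Re c0, Re c1, Re c2, Re c3:] x)" for x
      unfolding f norm_exp_eq_Re
      by (simp add: algebra_simps power2_eq_square power3_eq_cube)
    then show ?thesis using exp_poly_shift_le that by metis
  qed
  have K0: "0 \<le> K"
  proof -
    have pos: "0 < cmod (f x)" for x by (simp add: f)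
    have "0 < K * (cmod (f (0 - 1)) + cmod (f (0 + 1)))"
      using K[of 0 0] pos[of "0 + 0"] by linarith
    then show ?thesis
      by (metis add_nonneg_nonneg linorder_not_le mult_nonpos_nonneg norm_ge_zero order_less_imp_le)
  qed
  have "bounded (L1 ` {t-1..t+1})" "bounded (L2 ` {t-1..t+1})"
    unfolding L1_def L2_def
    by (intro compact_imp_bounded compact_continuous_image continuous_intros compact_Icc)+
  then obtain B1 B2 where B1: "\<And>s. s \<in> {t-1..t+1} \<Longrightarrow> cmod (L1 s) \<le> B1"
    and B2: "\<And>s. s \<in> {t-1..t+1} \<Longrightarrow> cmod (L2 s) \<le> B2"
    unfolding bounded_iff by blast
  \<comment> \<open>For \<open>s\<close> within distance 1 of \<open>t\<close> the coefficients are bounded by compactness, and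
    \<open>f (s + u)\<close> is controlled by \<open>f\<close> at \<open>t - 1 + u\<close> and \<open>t + 1 + u\<close>.\<close>
  define H where "H = (\<lambda>u. K * (B1 * (I (t - 1) j u + I (t + 1) j u)
     + B2 * (I (t - 1) (j + 1) u + I (t + 1) (j + 1) u)
     + cmod (3 * c3) * (I (t - 1) (j + 2) u + I (t + 1) (j + 2) u)))"
  have I_le: "I s k u \<le> K * (I (t - 1) k u + I (t + 1) k u)" if "s \<in> {t-1..t+1}" for s k u
  proof -
    have "cmod (f (s + u)) \<le> K * (cmod (f (t - 1 + u)) + cmod (f (t + 1 + u)))"
      using K[of "s - t" "t + u"] that by (auto simp: algebra_simps abs_le_iff)
    then have "cmod (f (s + u)) * (\<bar>u\<bar> ^ k * cmod (g u))
        \<le> (K * (cmod (f (t - 1 + u)) + cmod (f (t + 1 + u)))) * (\<bar>u\<bar> ^ k * cmod (g u))"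
      by (rule mult_right_mono) simp
    then show ?thesis by (simp add: I_def algebra_simps)
  qed
  have I0: "0 \<le> I s k u" for s k u by (simp add: I_def)

  have "((\<lambda>s. LINT u|lborel. f (s + u) * w j u) has_vector_derivative
      (LINT u|lborel. L1 (t + u) * f (t + u) * w j u)) (at t)"
  proof (rule has_vector_derivative_integral_dominated[where a = "t - 1" and b = "t + 1" and H = H])
    show "integrable lborel H" unfolding H_def
      by (intro Bochner_Integration.integrable_add integrable_mult_right intI)
    show "(\<lambda>u. L1 (t + u) * f (t + u) * w j u) \<in> borel_measurable lborel"
      unfolding F'_eq
      by (intro borel_measurable_add borel_measurable_times borel_measurable_const
            borel_measurable_integrable int_fw)
    show "((\<lambda>r. f (r + u) * w j u) has_vector_derivative L1 (s + u) * f (s + u) * w j u) (at s)"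
      for s u
    proof (rule has_vector_derivative_mult_left)
      have "((\<lambda>z. exp (c0 + c1 * (z + of_real u) + c2 * (z + of_real u)\<^sup>2 + c3 * (z + of_real u) ^ 3))
          has_field_derivative L1 (s + u) * f (s + u)) (at (of_real s))"
        by (auto intro!: derivative_eq_intros simp: f L1_def algebra_simps)
      from has_vector_derivative_real_field[OF this]
      show "((\<lambda>r. f (r + u)) has_vector_derivative L1 (s + u) * f (s + u)) (at s)"
        by (simp add: f)
    qed
    show "cmod (L1 (s + u) * f (s + u) * w j u) \<le> H u" if s: "s \<in> {t-1..t+1}" for s u
    proof -
      have "cmod (L1 (s + u) * f (s + u) * w j u)
          \<le> cmod (L1 s) * I s j u + cmod (L2 s) * I s (j + 1) u + cmod (3 * c3) * I s (j + 2) u"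
        unfolding F'_eq
        by (intro order_trans[OF norm_triangle_ineq] add_mono)
           (simp_all only: norm_mult[of "L1 s"] norm_mult[of "L2 s"] norm_mult[of "3 * c3"] norm_fw)
      also have "\<dots> \<le> B1 * (K * (I (t - 1) j u + I (t + 1) j u))
          + B2 * (K * (I (t - 1) (j + 1) u + I (t + 1) (j + 1) u))
          + cmod (3 * c3) * (K * (I (t - 1) (j + 2) u + I (t + 1) (j + 2) u))"
        using B1[OF s] B2[OF s]
        by (intro add_mono mult_mono I_le s I0 order_refl norm_ge_zero) (auto intro: order_trans[OF norm_ge_zero])
      also have "\<dots> = H u" by (simp add: H_def algebra_simps)
      finally show ?thesis .
    qed
  qed (use int_fw in auto)
  also have "(LINT u|lborel. L1 (t + u) * f (t + u) * w j u)
      = L1 t * (LINT u|lborel. f (t + u) * w j u) + L2 t * (LINT u|lborel. f (t + u) * w (j + 1) u)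
        + 3 * c3 * (LINT u|lborel. f (t + u) * w (j + 2) u)"
    unfolding F'_eq
    by (subst Bochner_Integration.integral_add,
        (intro Bochner_Integration.integrable_add integrable_mult_right int_fw)+)+
       (simp only: integral_mult_right_zero)
  finally show ?thesis
    unfolding chirplet_eq L1_def L2_def .
qed

section \<open>The estimators as algebraic consequences of the recursion\<close>

text \<open>The coefficients \<open>L1\<close>, \<open>L2\<close>, \<open>c\<close> stand for the first, second and (constant) third derivative of
  the exponent of \<open>f\<close>. Each time derivative of \<open>T\<^sub>0'/T\<^sub>0\<close> is linear in them, and the estimators solve the
  resulting linear equations.\<close>

lemma estimators_of_chirplet_recursion:
  fixes f g :: "real \<Rightarrow> complex" and L1 L2 :: "real \<Rightarrow> complex" and c :: complex
  assumes T_deriv: "\<And>j s. ((\<lambda>s. chirplet f (mono_window j g) s \<xi> l) has_vector_derivative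
      L1 s * chirplet f (mono_window j g) s \<xi> l
      + L2 s * chirplet f (mono_window (j + 1) g) s \<xi> l
      + c / 2 * chirplet f (mono_window (j + 2) g) s \<xi> l) (at s)"
    and L1: "\<And>s. (L1 has_vector_derivative L2 s) (at s)"
    and L2: "\<And>s. (L2 has_vector_derivative c) (at s)"
    and T0: "chirplet f g t \<xi> l \<noteq> 0"
    and q0: "q 0 f g t \<xi> l \<noteq> 0"
    and den: "2 + dt (\<lambda>t \<xi> l. q 1 f g t \<xi> l / q 0 f g t \<xi> l) t \<xi> l \<noteq> 0"
  shows "\<theta>_est f g t \<xi> l = c / (2 * complex_of_real pi * \<i>)"
    and "\<mu>_est f g t \<xi> l = L2 t / (2 * complex_of_real pi * \<i>)"
    and "\<omega>_est f g t \<xi> l = L1 t / (2 * complex_of_real pi * \<i>)"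
proof -
  define T where "T = (\<lambda>j s. chirplet f (mono_window j g) s \<xi> l)"
  define R where "R = (\<lambda>j s. T j s / T 0 s)"
  define dR where "dR = (\<lambda>j s. L2 s * (R (j + 1) s - R j s * R 1 s)
      + c / 2 * (R (j + 2) s - R j s * R 2 s))"
  define Q0 where "Q0 = (\<lambda>s. 1 + dR 1 s)"
  define Q1 where "Q1 = (\<lambda>s. 2 * R 1 s + dR 2 s)"
  define M where "M = (\<lambda>s. L1 s + L2 s * R 1 s + c / 2 * R 2 s)"
  define U where "U = {s. T 0 s \<noteq> 0}"
  have T: "(T j has_vector_derivative L1 s * T j s + L2 s * T (j + 1) s + c / 2 * T (j + 2) s) (at s)"
    for j s using T_deriv[of j s] unfolding T_def .
  have "continuous_on UNIV (T 0)"
    by (intro continuous_at_imp_continuous_on ballI has_vector_derivative_continuous[OF T])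
  then have "open U" unfolding U_def
    by (intro open_Collect_neq continuous_on_const)
  have ev_U: "eventually (\<lambda>s. s \<in> U) (nhds s)" if "s \<in> U" for s
    using \<open>open U\<close> that eventually_nhds_in_open by blast
  have tU: "t \<in> U" using T0 by (simp add: U_def T_def mono_window_0)
  have chirplet_T: "chirplet f g s \<xi> l = T 0 s" for s by (simp add: T_def mono_window_0)
  have T_ratio: "T_ratio j f g s \<xi> l = R j s" for j s
    by (simp add: T_ratio_def R_def chirplet_T) (simp add: T_def)
  have R0: "R 0 s = 1" if "s \<in> U" for s using that by (simp add: R_def U_def)
  have R_deriv: "(R j has_vector_derivative dR j s) (at s)" if "s \<in> U" for j s
  proof -
    have T0s: "T 0 s \<noteq> 0" using that by (simp add: U_def)
    have "((L1 s * T j s + L2 s * T (j + 1) s + c / 2 * T (j + 2) s) * T 0 s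
        - T j s * (L1 s * T 0 s + L2 s * T (0 + 1) s + c / 2 * T (0 + 2) s)) / (T 0 s)\<^sup>2 = dR j s"
      using T0s by (simp add: R_def dR_def numeral_2_eq_2 divide_simps) (simp add: algebra_simps)
    with has_vector_derivative_divide_field[OF T[of j s] T[of 0 s] T0s] show ?thesis
      unfolding R_def by simp
  qed
  have dR_deriv: "\<exists>D. (dR j has_vector_derivative D) (at s)" if "s \<in> U" for j s
    unfolding dR_def
    by (rule exI, rule has_vector_derivative_add[OF
          has_vector_derivative_mult[OF L2 has_vector_derivative_diff[OF
            R_deriv has_vector_derivative_mult[OF R_deriv R_deriv]]]
          has_vector_derivative_mult_right[OF has_vector_derivative_diff[OF
            R_deriv has_vector_derivative_mult[OF R_deriv R_deriv]]]]) (use that in auto)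
  have dt_ratio: "dt (T_ratio j f g) s \<xi> l = dR j s" if "s \<in> U" for j s
    by (rule dt_eqI[OF R_deriv[OF that]]) (simp add: T_ratio)
  have q0_eq: "q 0 f g s \<xi> l = Q0 s" and q1_eq: "q 1 f g s \<xi> l = Q1 s" if "s \<in> U" for s
    using R0[OF that] dt_ratio[OF that] by (simp_all add: q_def T_ratio Q0_def Q1_def numeral_2_eq_2)
  obtain Q0' where Q0': "(Q0 has_vector_derivative Q0') (at t)"
  proof -
    obtain D where "(dR 1 has_vector_derivative D) (at t)" using dR_deriv[OF tU] by blast
    then have "(Q0 has_vector_derivative 0 + D) (at t)"
      unfolding Q0_def by (intro has_vector_derivative_add has_vector_derivative_const)
    then show ?thesis by (rule that)
  qed
  obtain Q1' where Q1': "(Q1 has_vector_derivative Q1') (at t)"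
  proof -
    obtain D where D: "(dR 2 has_vector_derivative D) (at t)" using dR_deriv[OF tU] by blast
    have "(Q1 has_vector_derivative 2 * dR 1 t + D) (at t)"
      unfolding Q1_def
      by (intro has_vector_derivative_add has_vector_derivative_mult_right R_deriv tU D)
    then show ?thesis by (rule that)
  qed
  have ev_Q0: "eventually (\<lambda>s. Q0 s \<noteq> 0) (nhds t)"
  proof -
    have "isCont Q0 t" using Q0' has_vector_derivative_continuous by blast
    moreover have "Q0 t \<noteq> 0" using q0 q0_eq[OF tU] by simp
    ultimately have "eventually (\<lambda>s. Q0 s \<noteq> 0) (at t)"
      unfolding isCont_def by (rule tendsto_imp_eventually_ne)
    with \<open>Q0 t \<noteq> 0\<close> show ?thesis by (simp add: eventually_nhds_conv_at)
  qed
  have Q0t: "Q0 t \<noteq> 0" using q0 q0_eq[OF tU] by simp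

  have logderiv: "T_logderiv f g s \<xi> l = M s" if "s \<in> U" for s
  proof -
    have "dt (chirplet f g) s \<xi> l = L1 s * T 0 s + L2 s * T 1 s + c / 2 * T 2 s"
      by (rule dt_eqI[OF T[of 0 s, unfolded add_0]]) (simp add: chirplet_T)
    then show ?thesis using that
      by (simp add: T_logderiv_def chirplet_T M_def R_def U_def field_simps)
  qed
  have M_deriv: "(M has_vector_derivative L2 s * Q0 s + c / 2 * Q1 s) (at s)" if "s \<in> U" for s
  proof -
    have "(M has_vector_derivative L2 s + (L2 s * dR 1 s + c * R 1 s) + c / 2 * dR 2 s) (at s)"
      unfolding M_def
      by (intro has_vector_derivative_add has_vector_derivative_mult has_vector_derivative_mult_right
          L1 L2 R_deriv that)
    then show ?thesis by (simp add: Q0_def Q1_def algebra_simps)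
  qed
  have dt_logderiv: "dt (T_logderiv f g) s \<xi> l = L2 s * Q0 s + c / 2 * Q1 s" if "s \<in> U" for s
    by (rule dt_eqI[OF M_deriv[OF that]]) (rule eventually_mono[OF ev_U[OF that] logderiv])
  have dt2_logderiv: "dt (dt (T_logderiv f g)) t \<xi> l = L2 t * Q0' + c * Q0 t + c / 2 * Q1'"
    by (rule dt_eqI[where h = "\<lambda>s. L2 s * Q0 s + c / 2 * Q1 s"])
       (rule has_vector_derivative_add[OF has_vector_derivative_mult[OF L2 Q0']
               has_vector_derivative_mult_right[OF Q1']],
        rule eventually_mono[OF ev_U[OF tU] dt_logderiv])
  have dt_q0: "dt (q 0 f g) t \<xi> l = Q0'"
    by (rule dt_eqI[OF Q0']) (rule eventually_mono[OF ev_U[OF tU] q0_eq])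
  have dt_q1: "dt (q 1 f g) t \<xi> l = Q1'"
    by (rule dt_eqI[OF Q1']) (rule eventually_mono[OF ev_U[OF tU] q1_eq])

  define S where "S = (Q1' * Q0 t - Q1 t * Q0') / (Q0 t)\<^sup>2"
  have quot: "((\<lambda>s. Q1 s / Q0 s) has_vector_derivative S) (at t)"
    unfolding S_def by (rule has_vector_derivative_divide_field[OF Q1' Q0' Q0t])
  have dt_quot: "dt (\<lambda>t \<xi> l. q 1 f g t \<xi> l / q 0 f g t \<xi> l) t \<xi> l = S"
    by (rule dt_eqI[OF quot], rule eventually_mono[OF ev_U[OF tU]]) (simp only: q0_eq q1_eq)
  have S: "2 + S \<noteq> 0" using den dt_quot by simp
  have dt_theta: "dt (\<lambda>t \<xi> l. dt (T_logderiv f g) t \<xi> l / q 0 f g t \<xi> l) t \<xi> l = c + c / 2 * S"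
  proof (rule dt_eqI)
    show "((\<lambda>s. L2 s + c / 2 * (Q1 s / Q0 s)) has_vector_derivative c + c / 2 * S) (at t)"
      by (rule has_vector_derivative_add[OF L2 has_vector_derivative_mult_right[OF quot]])
    show "eventually (\<lambda>s. dt (T_logderiv f g) s \<xi> l / q 0 f g s \<xi> l = L2 s + c / 2 * (Q1 s / Q0 s)) (nhds t)"
      using ev_U[OF tU] ev_Q0
      by eventually_elim (simp add: dt_logderiv q0_eq field_simps)
  qed
  have half: "c + c / 2 * S = c / 2 * (2 + S)" by (simp add: algebra_simps)
  show theta: "\<theta>_est f g t \<xi> l = c / (2 * complex_of_real pi * \<i>)"
    unfolding \<theta>_est_def dt_theta dt_quot half using S by simp

  \<comment> \<open>\<open>E\<close> is the determinant of the linear system that the first and second derivatives of \<open>M\<close> form in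
    the unknowns \<open>L2 t\<close> and \<open>c / 2\<close>.\<close>
  define E where "E = 2 * (Q0 t)\<^sup>2 + Q0 t * Q1' - Q1 t * Q0'"
  have "E = (Q0 t)\<^sup>2 * (2 + S)" using Q0t by (simp add: E_def S_def field_simps)
  then have E: "E \<noteq> 0" using Q0t S by simp
  have "(2 * Q0 t + Q1') * (L2 t * Q0 t + c / 2 * Q1 t)
      - Q1 t * (L2 t * Q0' + c * Q0 t + c / 2 * Q1') = L2 t * E"
    by (simp add: E_def algebra_simps power2_eq_square)
  then show mu: "\<mu>_est f g t \<xi> l = L2 t / (2 * complex_of_real pi * \<i>)"
    unfolding \<mu>_est_def dt2_logderiv dt_q0 dt_q1 dt_logderiv[OF tU] q0_eq[OF tU] q1_eq[OF tU]
    using E by (simp add: E_def[symmetric])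
  show "\<omega>_est f g t \<xi> l = L1 t / (2 * complex_of_real pi * \<i>)"
    unfolding \<omega>_est_def theta mu T_ratio logderiv[OF tU] M_def by (simp add: field_simps)
qed

section \<open>Exactness of the estimators for cubic chirps\<close>

lemma poly_degree_le_3:
  fixes p :: "'a::comm_semiring_1 poly"
  assumes "degree p \<le> 3"
  shows "poly p x = coeff p 0 + coeff p 1 * x + coeff p 2 * x\<^sup>2 + coeff p 3 * x ^ 3"
proof -
  have "poly p x = (\<Sum>i\<le>3. coeff p i * x ^ i)"
    unfolding poly_altdef using assms by (intro sum.mono_neutral_left) (auto simp: coeff_eq_0)
  then show ?thesis by (simp add: numeral_3_eq_3 numeral_2_eq_2 atMost_Suc algebra_simps)
qed

theorem proposition1:
  fixes g f :: "real \<Rightarrow> complex" and A \<phi> :: "real \<Rightarrow> real" and t \<xi> l :: real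
  assumes "schwartz g"
    and "\<And>x. f x = complex_of_real (A x) * exp (2 * complex_of_real pi * \<i> * complex_of_real (\<phi> x))"
    and "\<And>x. A x > 0"
    and "\<exists>p :: real poly. degree p \<le> 3 \<and> (\<forall>x. ln (A x) = poly p x)"
    and "\<exists>p :: real poly. degree p \<le> 3 \<and> (\<forall>x. \<phi> x = poly p x)"
    and "\<And>s j. integrable lborel (\<lambda>x. cmod (f x) * \<bar>x - s\<bar> ^ j * cmod (g (x - s)))"
    and "chirplet f g t \<xi> l \<noteq> 0"
    and "q 0 f g t \<xi> l \<noteq> 0"
    and "2 + dt (\<lambda>t \<xi> l. q 1 f g t \<xi> l / q 0 f g t \<xi> l) t \<xi> l \<noteq> 0"
  shows "Re (\<theta>_est f g t \<xi> l) = (deriv ^^ 3) \<phi> t \<and>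
         Re (\<mu>_est f g t \<xi> l) = (deriv ^^ 2) \<phi> t \<and>
         Re (\<omega>_est f g t \<xi> l) = deriv \<phi> t"
proof -
  obtain p where p: "degree p \<le> 3" "\<And>x. ln (A x) = poly p x" using assms(4) by blast
  obtain r where r: "degree r \<le> 3" "\<And>x. \<phi> x = poly r x" using assms(5) by blast
  define a where "a = coeff p"
  define b where "b = coeff r"
  define c where "c = (\<lambda>k. complex_of_real (a k) + 2 * complex_of_real pi * \<i> * complex_of_real (b k))"
  have lnA: "ln (A x) = a 0 + a 1 * x + a 2 * x\<^sup>2 + a 3 * x ^ 3" for x
    by (simp add: p(2) poly_degree_le_3[OF p(1)] a_def)
  have phi: "\<phi> = (\<lambda>x. b 0 + b 1 * x + b 2 * x\<^sup>2 + b 3 * x ^ 3)"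
    by (simp add: r(2) poly_degree_le_3[OF r(1)] b_def fun_eq_iff)
  have f: "f x = exp (c 0 + c 1 * of_real x + c 2 * (of_real x)\<^sup>2 + c 3 * (of_real x) ^ 3)" for x
  proof -
    have "f x = exp (of_real (ln (A x))) * exp (2 * complex_of_real pi * \<i> * complex_of_real (\<phi> x))"
      using assms(2)[of x] assms(3)[of x] by (simp add: exp_of_real)
    then show ?thesis
      unfolding exp_add[symmetric] lnA phi by (simp add: c_def algebra_simps)
  qed
  have "nth_vderiv 0 g differentiable (at x)" for x
    using assms(1) by (simp add: schwartz_def)
  then have g: "continuous_on UNIV g"
    by (simp add: nth_vderiv_def differentiable_imp_continuous_within continuous_at_imp_continuous_on)

  define L1 where "L1 = (\<lambda>s::real. c 1 + 2 * c 2 * of_real s + 3 * c 3 * (of_real s)\<^sup>2)"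
  define L2 where "L2 = (\<lambda>s::real. 2 * c 2 + 6 * c 3 * of_real s)"
  have L1: "(L1 has_vector_derivative L2 s) (at s)" for s
    unfolding L1_def L2_def
    by (rule has_vector_derivative_real_field) (auto intro!: derivative_eq_intros)
  have L2: "(L2 has_vector_derivative 6 * c 3) (at s)" for s
    unfolding L2_def
    by (rule has_vector_derivative_real_field) (auto intro!: derivative_eq_intros)
  have T: "((\<lambda>s. chirplet f (mono_window j g) s \<xi> l) has_vector_derivative
      L1 s * chirplet f (mono_window j g) s \<xi> l
      + L2 s * chirplet f (mono_window (j + 1) g) s \<xi> l
      + 6 * c 3 / 2 * chirplet f (mono_window (j + 2) g) s \<xi> l) (at s)" for j s
    using chirplet_cubic_has_vector_derivative[OF f g assms(6), of j \<xi> l s]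
    by (simp add: L1_def L2_def)
  have d1: "deriv \<phi> = (\<lambda>x. b 1 + 2 * b 2 * x + 3 * b 3 * x\<^sup>2)"
    unfolding phi by (rule ext, rule DERIV_imp_deriv) (auto intro!: derivative_eq_intros)
  have d2: "deriv (deriv \<phi>) = (\<lambda>x. 2 * b 2 + 6 * b 3 * x)"
    unfolding d1 by (rule ext, rule DERIV_imp_deriv) (auto intro!: derivative_eq_intros)
  have d3: "deriv (deriv (deriv \<phi>)) = (\<lambda>x. 6 * b 3)"
    unfolding d2 by (rule ext, rule DERIV_imp_deriv) (auto intro!: derivative_eq_intros)
  \<comment> \<open>Dividing by \<open>2 \<pi> \<i>\<close> turns imaginary parts into real parts, and \<open>\<phi>\<close> is the imaginary part of the
    exponent up to the factor \<open>2 \<pi>\<close>.\<close>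
  have Re_div: "Re (z / (2 * complex_of_real pi * \<i>)) = Im z / (2 * pi)" for z
    by (simp add: Re_divide power2_eq_square)
  have Im_c: "Im (c k) = 2 * pi * b k" for k by (simp add: c_def)
  note est = estimators_of_chirplet_recursion[OF T L1 L2 assms(7-9)]
  have deriv_pow: "(deriv ^^ 2) \<phi> = deriv (deriv \<phi>)" "(deriv ^^ 3) \<phi> = deriv (deriv (deriv \<phi>))"
    by (simp_all only: numeral_2_eq_2 numeral_3_eq_3 funpow.simps o_def id_def)
  show ?thesis
    unfolding est Re_div deriv_pow
    unfolding d3 unfolding d2 unfolding d1
    by (simp add: L1_def L2_def Im_c Im_power2 field_simps)
qed

end
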